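(* Let $u,v\in\mathbb{R}(x,y)$ be rational functions. If $\phi(x,y)=(u(x,y),v(x,y))$ satisfies the projective translation equation $$(1-z)\,\phi(\mathbf{x})=\phi\Big(\phi(\mathbf{x}z)\,\frac{1-z}{z}\Big),\qquad\mathbf{x}=(x,y),$$ and the boundary condition $\lim_{z\to0}\phi(\mathbf{x}z)/z=\mathbf{x}$, then $u,v$ satisfy the system of partial differential equations $$\begin{cases}(xu_{xx}+yu_{xy})(vu_y-uv_y)+(yu_{yy}+xu_{xy})(uv_x-vu_x)=2(u-xu_x-yu_y)(u_xv_y-u_yv_x),\\ (xv_{xx}+yv_{xy})(vu_y-uv_y)+(yv_{yy}+xv_{xy})(uv_x-vu_x)=2(v-xv_x-yv_y)(u_xv_y-u_yv_x).\end{cases}$$ Conversely, for any pair of rational functions $u,v$ satisfying this system and the boundary condition $\lim_{z\to0}\phi(\mathbf{x}z)/z=\mathbf{x}$ for $\phi=(u,v)$, the pair $\phi=(u,v)$ satisfies the projective translation equation.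
   Context: The functional equation is understood as an identity of pairs of rational functions in $x,y,z$ over $\mathbb{R}$, and the limit as an identity of rational functions in $x,y$ (i.e. for generic $(x,y)$). Subscripts denote partial derivatives. *)

theory Defs
  imports
    Complex_Main
    "HOL-Computational_Algebra.Computational_Algebra"
    "HOL-Computational_Algebra.Field_as_Ring"
begin

text \<open>
  A polynomial in \<open>x, y\<close> is a polynomial in \<open>y\<close> (outer variable) with coefficients
  that are polynomials in \<open>x\<close> (inner variable); likewise \<open>z\<close> is outermost in \<open>\<real>[x,y,z]\<close>.
\<close>

type_synonym ratfun2 = "real poly poly fract"
type_synonym ratfun3 = "real poly poly poly fract"

definition x2 :: ratfun2 where "x2 = to_fract [:[:0, 1:]:]"
definition y2 :: ratfun2 where "y2 = to_fract [:0, 1:]"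

definition const3 :: "real \<Rightarrow> ratfun3" where "const3 c = to_fract [:[:[:c:]:]:]"
definition x3 :: ratfun3 where "x3 = to_fract [:[:[:0, 1:]:]:]"
definition y3 :: ratfun3 where "y3 = to_fract [:[:0, 1:]:]"
definition z3 :: ratfun3 where "z3 = to_fract [:0, 1:]"


subsection \<open>Substitution\<close>

text \<open>\<open>\<iota>\<close> is the embedding of the real constants into the target ring.\<close>

definition poly2_eval :: "(real \<Rightarrow> 'a::comm_ring_1) \<Rightarrow> real poly poly \<Rightarrow> 'a \<Rightarrow> 'a \<Rightarrow> 'a" where
  "poly2_eval \<iota> p a b = poly (map_poly (\<lambda>c. poly (map_poly \<iota> c) a) p) b"

text \<open>
  Numerator and denominator are taken in lowest terms, so the substitution \<open>f(a, b)\<close> is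
  meaningful iff the reduced denominator of \<open>f\<close> does not vanish at \<open>(a, b)\<close>; otherwise the
  value of \<open>ratfun_subst\<close> is the junk value \<open>0\<close>.
\<close>

definition ratfun_subst_defined :: "(real \<Rightarrow> 'a::field) \<Rightarrow> ratfun2 \<Rightarrow> 'a \<Rightarrow> 'a \<Rightarrow> bool" where
  "ratfun_subst_defined \<iota> f a b \<longleftrightarrow> poly2_eval \<iota> (snd (quot_of_fract f)) a b \<noteq> 0"

definition ratfun_subst :: "(real \<Rightarrow> 'a::field) \<Rightarrow> ratfun2 \<Rightarrow> 'a \<Rightarrow> 'a \<Rightarrow> 'a" where
  "ratfun_subst \<iota> f a b =
     poly2_eval \<iota> (fst (quot_of_fract f)) a b / poly2_eval \<iota> (snd (quot_of_fract f)) a b"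


subsection \<open>Partial derivatives\<close>

text \<open>The extension of a derivation to the fraction field, by the quotient rule.\<close>

definition fract_deriv ::
    "('a \<Rightarrow> 'a) \<Rightarrow> 'a::{ring_gcd,idom_divide,semiring_gcd_mult_normalize} fract \<Rightarrow> 'a fract" where
  "fract_deriv d f =
     (let (p, q) = quot_of_fract f in Fract (d p * q - p * d q) (q ^ 2))"

definition dx :: "ratfun2 \<Rightarrow> ratfun2" where "dx = fract_deriv (map_poly pderiv)"
definition dy :: "ratfun2 \<Rightarrow> ratfun2" where "dy = fract_deriv pderiv"

lemma fract_deriv_Fract:
  fixes p q :: "'a::{ring_gcd,idom_divide,semiring_gcd_mult_normalize}"
  assumes leibniz: "\<And>a b. d (a * b) = d a * b + a * d b" and "q \<noteq> 0"
  shows "fract_deriv d (Fract p q) = Fract (d p * q - p * d q) (q ^ 2)"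
proof -
  obtain r s where rs: "quot_of_fract (Fract p q) = (r, s)" by (metis surj_pair)
  have "s \<noteq> 0" using snd_quot_of_fract_nonzero[of "Fract p q"] rs by simp
  have "Fract r s = Fract p q" using Fract_quot_of_fract[of "Fract p q"] rs by simp
  hence eq: "r * q = p * s" using \<open>s \<noteq> 0\<close> \<open>q \<noteq> 0\<close> by (simp add: eq_fract)
  have deq: "d r * q + r * d q = d p * s + p * d s"
    using arg_cong[OF eq, of d] by (simp add: leibniz)
  have "(d r * s - r * d s) * q ^ 2 = (d p * q - p * d q) * s ^ 2"
    using eq deq by algebra
  thus ?thesis using \<open>s \<noteq> 0\<close> \<open>q \<noteq> 0\<close> by (simp add: fract_deriv_def rs eq_fract)
qed


subsection \<open>Projective translation equation, boundary condition and PDE system\<close>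

text \<open>
  \<open>(1 - z) \<phi>(\<^bold>x) = \<phi>(\<phi>(\<^bold>x z) (1 - z) / z)\<close> in \<open>\<real>(x,y,z)\<close> for \<open>\<phi> = (u, v)\<close>; the identity
  includes that the outer composition makes sense (the inner substitutions always do).
\<close>

definition projective_translation_equation :: "ratfun2 \<Rightarrow> ratfun2 \<Rightarrow> bool" where
  "projective_translation_equation u v \<longleftrightarrow>
     (let a = ratfun_subst const3 u (x3 * z3) (y3 * z3) * ((1 - z3) / z3);
          b = ratfun_subst const3 v (x3 * z3) (y3 * z3) * ((1 - z3) / z3)
      in ratfun_subst_defined const3 u a b \<and> ratfun_subst_defined const3 v a b \<and>
         (1 - z3) * ratfun_subst const3 u x3 y3 = ratfun_subst const3 u a b \<and>
         (1 - z3) * ratfun_subst const3 v x3 y3 = ratfun_subst const3 v a b)"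

text \<open>
  \<open>lim\<^bsub>z\<rightarrow>0\<^esub> \<phi>(\<^bold>x z) / z = \<^bold>x\<close> for generic real \<open>\<^bold>x\<close>, i.e. off the zero set of some nonzero
  polynomial \<open>D\<close>. Generically, \<open>z \<mapsto> \<phi>(\<^bold>x z)\<close> has no poles in a punctured neighbourhood of \<open>0\<close>,
  so junk values play no role in the limit.
\<close>

definition boundary_condition :: "ratfun2 \<Rightarrow> ratfun2 \<Rightarrow> bool" where
  "boundary_condition u v \<longleftrightarrow>
     (\<exists>D::real poly poly. D \<noteq> 0 \<and>
       (\<forall>a b. poly2_eval id D a b \<noteq> 0 \<longrightarrow>
          ((\<lambda>t. ratfun_subst id u (a * t) (b * t) / t) \<longlongrightarrow> a) (at 0) \<and>
          ((\<lambda>t. ratfun_subst id v (a * t) (b * t) / t) \<longlongrightarrow> b) (at 0)))"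

definition projective_pde_system :: "ratfun2 \<Rightarrow> ratfun2 \<Rightarrow> bool" where
  "projective_pde_system u v \<longleftrightarrow>
     (x2 * dx (dx u) + y2 * dy (dx u)) * (v * dy u - u * dy v)
       + (y2 * dy (dy u) + x2 * dy (dx u)) * (u * dx v - v * dx u)
       = 2 * (u - x2 * dx u - y2 * dy u) * (dx u * dy v - dy u * dx v) \<and>
     (x2 * dx (dx v) + y2 * dy (dx v)) * (v * dy u - u * dy v)
       + (y2 * dy (dy v) + x2 * dy (dx v)) * (u * dx v - v * dx u)
       = 2 * (v - x2 * dx v - y2 * dy v) * (dx u * dy v - dy u * dx v)"

end

theory Submission
  imports Defs
begin

text \<open>
  The family \<open>\<phi>\<^sup>t(\<^bold>x) = \<phi>(\<^bold>x t) / t\<close> tends to the identity as \<open>t \<rightarrow> 0\<close> by the boundary condition,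
  and the translation equation says \<open>\<phi>\<^sup>1\<^sup>-\<^sup>z \<circ> \<phi>\<^sup>z = \<phi>\<^sup>1\<close>. So it expresses that the family is a flow, and
  a flow is determined by its vector field \<open>(P, Q)\<close>. Because of the scaling in \<open>\<phi>\<^sup>t\<close> this field is
  homogeneous of degree 2, and it satisfies the first-order equations
  \<open>P f\<^sub>x + Q f\<^sub>y = x f\<^sub>x + y f\<^sub>y - f\<close> for \<open>f = u, v\<close>. The second-order system is what remains of these
  equations after eliminating \<open>P\<close> and \<open>Q\<close>: Cramer's rule expresses them through \<open>u\<close>, \<open>v\<close> and their
  first derivatives, and Euler's equation for homogeneous functions of degree 2 brings in the
  second derivatives. The predicate \<open>quadratic_generator\<close> records the homogeneity and the
  first-order equations. Under the boundary condition both the translation equation and the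
  differential system are equivalent to the existence of such a field: the elimination is in
  \<open>quadratic_generator_imp_pde_system\<close> and \<open>pde_system_imp_quadratic_generator\<close>, the flow argument in
  \<open>translation_equation_imp_quadratic_generator\<close> and
  \<open>quadratic_generator_imp_translation_equation\<close>.

  All of this is carried out algebraically in the field of Laurent series in \<open>z\<close> over \<open>\<real>(x,y)\<close>.
  It contains \<open>\<real>(x,y,z)\<close>, it carries the derivation with respect to \<open>z\<close> as well as the derivations
  of \<open>\<real>(x,y)\<close> acting on coefficients, and a power series can be evaluated at \<open>z = 0\<close>. The uniqueness
  theorem for differential equations becomes a recursion on coefficients
  (\<open>fls_evolution_unique\<close>). The boundary condition, which is a statement about real limits,
  enters only through its consequence that \<open>u(x z, y z) / z\<close> and \<open>v(x z, y z) / z\<close> are power series with constant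
  terms \<open>x\<close> and \<open>y\<close> (\<open>boundary_condition_ray\<close>).
\<close>

unbundle Formal_Power_Series.fps_syntax
unbundle Formal_Laurent_Series.fps_syntax


section \<open>Ring homomorphisms and substitution into polynomials\<close>

locale ring_map =
  fixes h :: "'a::comm_ring_1 \<Rightarrow> 'b::comm_ring_1"
  assumes one: "h 1 = 1" and add: "h (a + b) = h a + h b" and mult: "h (a * b) = h a * h b"
begin

lemma zero: "h 0 = 0"
  using add[of 0 0] by simp

lemma minus: "h (- a) = - h a"
  using add[of a "- a"] by (simp add: zero eq_neg_iff_add_eq_0 add.commute)

lemma diff: "h (a - b) = h a - h b"
  using add[of a "- b"] by (simp add: minus)

lemma power: "h (a ^ n) = h a ^ n"
  by (induction n) (auto simp: one mult)

end

lemma ring_map_comp: "ring_map g \<Longrightarrow> ring_map h \<Longrightarrow> ring_map (\<lambda>a. g (h a))"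
  by (simp add: ring_map_def)

lemma ring_map_nonzero:
  fixes h :: "'a::field \<Rightarrow> 'b::field"
  assumes "ring_map h" "a \<noteq> 0"
  shows "h a \<noteq> 0"
proof
  assume "h a = 0"
  hence "h (a * inverse a) = 0" by (simp only: ring_map.mult[OF assms(1)] mult_zero_left)
  thus False using assms by (simp add: ring_map.one)
qed

lemma ring_map_divide:
  fixes h :: "'a::field \<Rightarrow> 'b::field"
  assumes "ring_map h"
  shows "h (a / b) = h a / h b"
proof (cases "b = 0")
  case False
  have "h (a / b) * h b = h a" using False by (simp flip: ring_map.mult[OF assms])
  thus ?thesis using ring_map_nonzero[OF assms False] by (simp add: field_simps)
qed (simp add: ring_map.zero[OF assms])

lemma ring_map_inj:
  fixes h :: "'a::field \<Rightarrow> 'b::field"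
  assumes "ring_map h" "h a = h b"
  shows "a = b"
  using ring_map_nonzero[OF assms(1), of "a - b"] assms(2) by (auto simp: ring_map.diff[OF assms(1)])

lemma ring_map_map_poly:
  assumes "ring_map h"
  shows "ring_map (map_poly h)"
proof -
  interpret ring_map h by fact
  have 1: "map_poly h (p + q) = map_poly h p + map_poly h q" for p q
    by (rule poly_eqI) (simp add: coeff_map_poly zero add)
  have 2: "map_poly h (smult c p) = smult (h c) (map_poly h p)" for c p
    by (rule poly_eqI) (simp add: coeff_map_poly zero mult)
  have 3: "map_poly h (p * q) = map_poly h p * map_poly h q" for p q
    by (induction p) (simp_all add: map_poly_pCons 1 2 zero)
  show ?thesis
    by standard (simp_all add: 1 3 one)
qed

lemma ring_map_poly:
  assumes "ring_map h"
  shows "ring_map (\<lambda>p. poly (map_poly h p) a)"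
proof -
  interpret map_poly: ring_map "map_poly h" by (rule ring_map_map_poly[OF assms])
  show ?thesis by standard (simp_all add: map_poly.one map_poly.add map_poly.mult)
qed

lemma poly_ring_map_eqI:
  fixes g h :: "'a::comm_ring_1 poly \<Rightarrow> 'b::comm_ring_1"
  assumes "ring_map g" "ring_map h" "\<And>c. g [:c:] = h [:c:]" "g [:0, 1:] = h [:0, 1:]"
  shows "g p = h p"
proof (induction p)
  case 0
  show ?case using assms by (simp add: ring_map.zero)
next
  case (pCons c p)
  have eq: "pCons c p = [:c:] + [:0, 1:] * p" by simp
  show ?case unfolding eq
    by (simp only: ring_map.add[OF assms(1)] ring_map.add[OF assms(2)]
        ring_map.mult[OF assms(1)] ring_map.mult[OF assms(2)] pCons.IH assms(3,4))
qed

lemma poly2_ring_map_eqI: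
  fixes g h :: "'a::comm_ring_1 poly poly \<Rightarrow> 'b::comm_ring_1"
  assumes "ring_map g" "ring_map h" "\<And>c. g [:[:c:]:] = h [:[:c:]:]"
    "g [:[:0, 1:]:] = h [:[:0, 1:]:]" "g [:0, 1:] = h [:0, 1:]"
  shows "g p = h p"
proof (rule poly_ring_map_eqI[OF assms(1,2) _ assms(5)])
  fix c :: "'a poly"
  have const: "ring_map (\<lambda>c :: 'a poly. [:c:])" by standard (simp_all add: one_pCons)
  show "g [:c:] = h [:c:]"
    using poly_ring_map_eqI[OF ring_map_comp[OF assms(1) const] ring_map_comp[OF assms(2) const]]
      assms(3,4) by blast
qed

context
  fixes \<iota> :: "real \<Rightarrow> 'a::comm_ring_1"
  assumes \<iota>: "ring_map \<iota>"
begin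

lemma ring_map_poly2_eval: "ring_map (\<lambda>p. poly2_eval \<iota> p a b)"
  unfolding poly2_eval_def by (rule ring_map_poly[OF ring_map_poly[OF \<iota>]])

lemma poly2_eval_pCons:
  "poly2_eval \<iota> (pCons c p) a b = poly (map_poly \<iota> c) a + b * poly2_eval \<iota> p a b"
  by (simp add: poly2_eval_def map_poly_pCons)

lemma poly2_eval_0 [simp]: "poly2_eval \<iota> 0 a b = 0"
  by (simp add: poly2_eval_def)

lemma poly2_eval_1 [simp]: "poly2_eval \<iota> 1 a b = 1"
  using ring_map.one[OF ring_map_poly2_eval] .

lemma poly2_eval_const [simp]: "poly2_eval \<iota> [:[:c:]:] a b = \<iota> c"
  using ring_map.zero[OF \<iota>] by (simp add: poly2_eval_pCons map_poly_pCons)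

lemma poly2_eval_x [simp]: "poly2_eval \<iota> [:[:0, 1:]:] a b = a"
  using ring_map.zero[OF \<iota>] ring_map.one[OF \<iota>] by (simp add: poly2_eval_pCons map_poly_pCons)

lemma poly2_eval_y [simp]: "poly2_eval \<iota> [:0, 1:] a b = b"
  using ring_map.zero[OF \<iota>] ring_map.one[OF \<iota>]
  by (simp add: poly2_eval_pCons map_poly_pCons flip: one_pCons)

text \<open>
  The universal property of the polynomial ring: a homomorphism is the substitution of the images of
  \<open>x\<close> and \<open>y\<close>. So homomorphisms commute with substitution.
\<close>

lemma ring_map_eq_poly2_eval:
  assumes "ring_map h" "\<And>c. h [:[:c:]:] = \<iota> c"
  shows "h p = poly2_eval \<iota> p (h [:[:0, 1:]:]) (h [:0, 1:])"
  by (rule poly2_ring_map_eqI[OF assms(1) ring_map_poly2_eval]) (simp_all add: assms)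

end

lemma ring_map_poly2_eval_image:
  assumes "ring_map h" "ring_map \<iota>"
  shows "h (poly2_eval \<iota> p a b) = poly2_eval (\<lambda>c. h (\<iota> c)) p (h a) (h b)"
  using ring_map_eq_poly2_eval[OF ring_map_comp[OF assms]
      ring_map_comp[OF assms(1) ring_map_poly2_eval[OF assms(2)]], of a b p]
  by (simp add: assms(2))


section \<open>Extending maps to fraction fields\<close>

text \<open>
  Numerator and denominator are taken in lowest terms, so that \<open>ratfun_subst\<close> is literally an
  instance. For \<open>g\<close> without zeros on nonzero elements the choice of the fraction is irrelevant.
\<close>

definition fract_extend ::
    "('a::{ring_gcd,idom_divide,semiring_gcd_mult_normalize} \<Rightarrow> 'b::field) \<Rightarrow> 'a fract \<Rightarrow> 'b" where
  "fract_extend g f = g (fst (quot_of_fract f)) / g (snd (quot_of_fract f))"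

lemma fract_cases:
  fixes f :: "'a::idom fract"
  obtains p q where "f = Fract p q" "q \<noteq> 0"
  by (cases f) auto

context
  fixes g :: "'a::{ring_gcd,idom_divide,semiring_gcd_mult_normalize} \<Rightarrow> 'b::field"
  assumes g: "ring_map g" and nonzero: "\<And>p. p \<noteq> 0 \<Longrightarrow> g p \<noteq> 0"
begin

lemma fract_extend_Fract:
  assumes "q \<noteq> 0"
  shows "fract_extend g (Fract p q) = g p / g q"
proof -
  obtain r s where rs: "quot_of_fract (Fract p q) = (r, s)" by (metis surj_pair)
  have s: "s \<noteq> 0" using snd_quot_of_fract_nonzero[of "Fract p q"] rs by simp
  have "Fract r s = Fract p q" using Fract_quot_of_fract[of "Fract p q"] rs by simp
  hence "r * q = p * s" using s assms by (simp add: eq_fract)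
  hence "g r * g q = g p * g s" by (simp flip: ring_map.mult[OF g])
  thus ?thesis using s assms nonzero by (simp add: fract_extend_def rs field_simps)
qed

lemma fract_extend_to_fract: "fract_extend g (to_fract p) = g p"
  by (simp add: fract_extend_def ring_map.one[OF g])

lemma ring_map_fract_extend: "ring_map (fract_extend g)"
proof
  show "fract_extend g 1 = 1"
    using fract_extend_to_fract[of 1] by (simp add: ring_map.one[OF g])
next
  fix a b :: "'a fract"
  obtain p q where a: "a = Fract p q" "q \<noteq> 0" by (rule fract_cases)
  obtain r s where b: "b = Fract r s" "s \<noteq> 0" by (rule fract_cases)
  show "fract_extend g (a + b) = fract_extend g a + fract_extend g b"
    using a b nonzero
    by (simp add: fract_extend_Fract ring_map.add[OF g] ring_map.mult[OF g] field_simps)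
  show "fract_extend g (a * b) = fract_extend g a * fract_extend g b"
    using a b nonzero
    by (simp add: fract_extend_Fract ring_map.mult[OF g])
qed

end

lemma ratfun_subst_conv_fract_extend:
  "ratfun_subst \<iota> f a b = fract_extend (\<lambda>p. poly2_eval \<iota> p a b) f"
  by (simp add: ratfun_subst_def fract_extend_def)

text \<open>
  Algebraic independence over \<open>\<real>\<close> ensures that every rational function can be substituted, and
  thereby that substitution is a homomorphism of fields.
\<close>

definition alg_independent :: "(real \<Rightarrow> 'a::field) \<Rightarrow> 'a \<Rightarrow> 'a \<Rightarrow> bool" where
  "alg_independent \<iota> a b \<longleftrightarrow> (\<forall>p. p \<noteq> 0 \<longrightarrow> poly2_eval \<iota> p a b \<noteq> 0)"

lemma alg_independent_nonzero:
  "alg_independent \<iota> a b \<Longrightarrow> p \<noteq> 0 \<Longrightarrow> poly2_eval \<iota> p a b \<noteq> 0"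
  by (simp add: alg_independent_def)

context
  fixes \<iota> :: "real \<Rightarrow> 'a::field" and a b :: 'a
  assumes \<iota>: "ring_map \<iota>" and indep: "alg_independent \<iota> a b"
begin

lemma ratfun_subst_defined: "ratfun_subst_defined \<iota> f a b"
  by (simp add: ratfun_subst_defined_def alg_independent_nonzero[OF indep])

lemma ratfun_subst_Fract:
  "q \<noteq> 0 \<Longrightarrow> ratfun_subst \<iota> (Fract p q) a b = poly2_eval \<iota> p a b / poly2_eval \<iota> q a b"
  unfolding ratfun_subst_conv_fract_extend
  by (rule fract_extend_Fract[OF ring_map_poly2_eval[OF \<iota>] alg_independent_nonzero[OF indep]])

lemma ring_map_ratfun_subst: "ring_map (\<lambda>f. ratfun_subst \<iota> f a b)"
  using ring_map_fract_extend[OF ring_map_poly2_eval[OF \<iota>, of a b] alg_independent_nonzero[OF indep]]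
  unfolding ratfun_subst_conv_fract_extend .

lemma ratfun_subst_to_fract: "ratfun_subst \<iota> (to_fract p) a b = poly2_eval \<iota> p a b"
  by (simp add: ratfun_subst_def \<iota>)

lemma ratfun_subst_x2 [simp]: "ratfun_subst \<iota> x2 a b = a"
  by (simp add: x2_def ratfun_subst_to_fract \<iota>)

lemma ratfun_subst_y2 [simp]: "ratfun_subst \<iota> y2 a b = b"
  by (simp add: y2_def ratfun_subst_to_fract \<iota>)

end

lemma ring_map_ratfun_subst_image:
  fixes h :: "'a::field \<Rightarrow> 'b::field"
  assumes "ring_map h" "ring_map \<iota>"
  shows "h (ratfun_subst \<iota> f a b) = ratfun_subst (\<lambda>c. h (\<iota> c)) f (h a) (h b)"
    and "ratfun_subst_defined \<iota> f a b \<longleftrightarrow> ratfun_subst_defined (\<lambda>c. h (\<iota> c)) f (h a) (h b)"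
  unfolding ratfun_subst_def ratfun_subst_defined_def ring_map_divide[OF assms(1)]
    ring_map_poly2_eval_image[OF assms, symmetric]
  using ring_map_nonzero[OF assms(1)] ring_map.zero[OF assms(1)] by auto

definition const2 :: "real \<Rightarrow> ratfun2" where
  "const2 c = to_fract [:[:c:]:]"

lemma ring_map_to_fract: "ring_map to_fract"
  by standard simp_all

lemma ring_map_const2: "ring_map const2"
  by standard (simp_all add: const2_def flip: one_pCons to_fract_add to_fract_mult)

lemma poly2_eval_const2_x2_y2: "poly2_eval const2 p x2 y2 = to_fract p"
  using ring_map_eq_poly2_eval[OF ring_map_const2 ring_map_to_fract, of p]
  by (simp add: const2_def x2_def y2_def)

lemma alg_independent_x2_y2: "alg_independent const2 x2 y2"
  by (simp add: alg_independent_def poly2_eval_const2_x2_y2)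

lemma ratfun_subst_const2_x2_y2: "ratfun_subst const2 f x2 y2 = f"
  by (simp add: ratfun_subst_def poly2_eval_const2_x2_y2 flip: Fract_conv_to_fract)


section \<open>Derivations\<close>

locale derivation =
  fixes d :: "'a::comm_ring_1 \<Rightarrow> 'a"
  assumes add: "d (a + b) = d a + d b" and mult: "d (a * b) = d a * b + a * d b"
begin

lemma zero: "d 0 = 0"
  using add[of 0 0] by simp

lemma one: "d 1 = 0"
  using mult[of 1 1] by simp

lemma minus: "d (- a) = - d a"
  using add[of a "- a"] by (simp add: zero eq_neg_iff_add_eq_0 add.commute)

lemma diff: "d (a - b) = d a - d b"
  using add[of a "- b"] by (simp add: minus)

lemma of_nat: "d (of_nat n) = 0"
  by (induction n) (simp_all add: zero add one)

lemma of_int: "d (of_int n) = 0"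
  by (cases n rule: int_diff_cases) (simp add: diff of_nat)

end

lemma derivation_divide:
  fixes d :: "'a::field \<Rightarrow> 'a"
  assumes "derivation d" "b \<noteq> 0"
  shows "d (a / b) = (d a * b - a * d b) / b ^ 2"
proof -
  have "d a = d (a / b) * b + a / b * d b"
    using derivation.mult[OF assms(1), of "a / b" b] assms(2) by simp
  thus ?thesis using assms(2) by (simp add: field_simps power2_eq_square)
qed

lemma derivation_poly2_eval:
  assumes \<iota>: "ring_map \<iota>" and "derivation d" and const: "\<And>c. d (\<iota> c) = 0"
  shows "d (poly2_eval \<iota> p a b) =
    poly2_eval \<iota> (map_poly pderiv p) a b * d a + poly2_eval \<iota> (pderiv p) a b * d b"
proof -
  interpret derivation d by fact
  have inner: "d (poly (map_poly \<iota> c) a) = poly (map_poly \<iota> (pderiv c)) a * d a" for c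
  proof (induction c)
    case (pCons k c)
    interpret ev: ring_map "\<lambda>p. poly (map_poly \<iota> p) a" by (rule ring_map_poly[OF \<iota>])
    show ?case using pCons ring_map.zero[OF \<iota>]
      by (simp add: map_poly_pCons pderiv_pCons ev.add add mult const algebra_simps)
  qed (simp add: zero)
  show ?thesis
  proof (induction p)
    case (pCons c p)
    interpret ev: ring_map "\<lambda>p. poly2_eval \<iota> p a b" by (rule ring_map_poly2_eval[OF \<iota>])
    show ?case using pCons
      by (simp add: map_poly_pCons pderiv_pCons ev.add poly2_eval_pCons[OF \<iota>] add mult inner algebra_simps)
  qed (simp add: poly2_eval_0[OF \<iota>] zero)
qed

lemma derivation_fract_deriv:
  fixes d :: "'a::{ring_gcd,idom_divide,semiring_gcd_mult_normalize} \<Rightarrow> 'a"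
  assumes "derivation d"
  shows "derivation (fract_deriv d)"
proof
  interpret derivation d by fact
  fix a b :: "'a fract"
  obtain p q where a: "a = Fract p q" "q \<noteq> 0" by (rule fract_cases)
  obtain r s where b: "b = Fract r s" "s \<noteq> 0" by (rule fract_cases)
  note simps = fract_deriv_Fract[of d, OF mult] add mult eq_fract
  show "fract_deriv d (a + b) = fract_deriv d a + fract_deriv d b"
    unfolding a(1) b(1) using a(2) b(2) by (simp add: simps) (simp add: algebra_simps power2_eq_square)
  show "fract_deriv d (a * b) = fract_deriv d a * b + a * fract_deriv d b"
    unfolding a(1) b(1) using a(2) b(2) by (simp add: simps) (simp add: algebra_simps power2_eq_square)
qed

lemma derivation_pderiv: "derivation (pderiv :: 'a::idom poly \<Rightarrow> _)"
  by standard (simp_all add: pderiv_add pderiv_mult algebra_simps)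

lemma derivation_map_poly:
  assumes "derivation d"
  shows "derivation (map_poly d)"
proof -
  interpret derivation d by fact
  have 1: "map_poly d (p + q) = map_poly d p + map_poly d q" for p q
    by (rule poly_eqI) (simp add: coeff_map_poly zero add)
  have 2: "map_poly d (smult c p) = smult (d c) p + smult c (map_poly d p)" for c p
    by (rule poly_eqI) (simp add: coeff_map_poly zero mult)
  have "map_poly d (p * q) = map_poly d p * q + p * map_poly d q" for p q
    by (induction p) (simp_all add: map_poly_pCons 1 2 zero algebra_simps)
  with 1 show ?thesis by unfold_locales
qed

lemma derivation_dx: "derivation dx"
  unfolding dx_def by (intro derivation_fract_deriv derivation_map_poly derivation_pderiv)

lemma derivation_dy: "derivation dy"
  unfolding dy_def by (intro derivation_fract_deriv derivation_pderiv)

lemma dx_Fract: "q \<noteq> 0 \<Longrightarrow> dx (Fract p q) =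
    Fract (map_poly pderiv p * q - p * map_poly pderiv q) (q ^ 2)"
  unfolding dx_def
  by (intro fract_deriv_Fract derivation.mult derivation_map_poly derivation_pderiv)

lemma dy_Fract: "q \<noteq> 0 \<Longrightarrow> dy (Fract p q) = Fract (pderiv p * q - p * pderiv q) (q ^ 2)"
  unfolding dy_def by (intro fract_deriv_Fract derivation.mult derivation_pderiv)

lemma dx_to_fract: "dx (to_fract p) = to_fract (map_poly pderiv p)"
  using dx_Fract[of 1 p] by (simp add: to_fract_def derivation.one derivation_map_poly derivation_pderiv)

lemma dy_to_fract: "dy (to_fract p) = to_fract (pderiv p)"
  using dy_Fract[of 1 p] by (simp add: to_fract_def)

lemma partials_simps [simp]:
  "dx x2 = 1" "dx y2 = 0" "dy x2 = 0" "dy y2 = 1" "dx (const2 c) = 0" "dy (const2 c) = 0"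
  by (simp_all add: x2_def y2_def const2_def dx_to_fract dy_to_fract map_poly_pCons map_poly_1 pderiv_pCons
      flip: one_pCons)

text \<open>
  The chain rule. It holds for every derivation that vanishes on the constants, and so serves for
  the derivative in the series variable and for derivations acting on coefficients alike.
\<close>

lemma derivation_ratfun_subst:
  assumes \<iota>: "ring_map \<iota>" and d: "derivation d" and const: "\<And>c. d (\<iota> c) = 0"
    and indep: "alg_independent \<iota> a b"
  shows "d (ratfun_subst \<iota> f a b) =
    ratfun_subst \<iota> (dx f) a b * d a + ratfun_subst \<iota> (dy f) a b * d b"
proof -
  obtain p q where f: "f = Fract p q" and q: "q \<noteq> 0" by (rule fract_cases)
  interpret ev: ring_map "\<lambda>p. poly2_eval \<iota> p a b" by (rule ring_map_poly2_eval[OF \<iota>])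
  have q0: "poly2_eval \<iota> q a b \<noteq> 0" by (rule alg_independent_nonzero[OF indep q])
  have q2: "q ^ 2 \<noteq> 0" using q by simp
  note subst = ratfun_subst_Fract[OF \<iota> indep]
  show ?thesis
    unfolding f dx_Fract[OF q] dy_Fract[OF q] subst[OF q] subst[OF q2] derivation_divide[OF d q0]
      derivation_poly2_eval[OF \<iota> d const] ev.diff ev.mult ev.power
    using q0 by (simp add: field_simps)
qed

text \<open>
  The chain rule for the identity \<open>f(x, y) = f\<close>: a derivation of \<open>\<real>(x,y)\<close> over \<open>\<real>\<close> is determined
  by its values on \<open>x\<close> and \<open>y\<close>.
\<close>

lemma derivation_ratfun2:
  assumes "derivation d" "\<And>c. d (const2 c) = 0"
  shows "d f = dx f * d x2 + dy f * d y2"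
  using derivation_ratfun_subst[OF ring_map_const2 assms alg_independent_x2_y2, of f]
  by (simp add: ratfun_subst_const2_x2_y2)

text \<open>
  The commutator of the two partial derivatives is a derivation over \<open>\<real>\<close> that kills \<open>x\<close> and \<open>y\<close>.
\<close>

lemma dx_dy_commute: "dx (dy f) = dy (dx f)"
proof -
  interpret x: derivation dx by (rule derivation_dx)
  interpret y: derivation dy by (rule derivation_dy)
  have "derivation (\<lambda>f. dx (dy f) - dy (dx f))"
    by standard (simp_all add: x.add y.add x.mult y.mult algebra_simps)
  from derivation_ratfun2[OF this, of f] show ?thesis
    by (simp add: x.zero y.zero x.one y.one)
qed


section \<open>Laurent expansions\<close>

definition fls_map :: "('a \<Rightarrow> 'b) \<Rightarrow> 'a::zero fls \<Rightarrow> 'b::zero fls" where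
  "fls_map h f = Abs_fls (\<lambda>n. h (f $$ n))"

lemma fls_map_nth:
  assumes "h 0 = 0"
  shows "fls_map h f $$ n = h (f $$ n)"
proof -
  obtain N where "\<forall>n<N. f $$ n = 0" by (elim fls_nth_vanishes_belowE)
  thus ?thesis unfolding fls_map_def
    by (intro nth_Abs_fls_ex_lower_bound exI[of _ N]) (simp add: assms)
qed

text \<open>
  A derivation may raise the subdegree. To compare the products in Leibniz' rule coefficientwise, all
  convolution sums must run over one common range, which the exact subdegrees do not provide.
\<close>

lemma fls_times_nth_bounds:
  fixes f g :: "'a::comm_ring_1 fls"
  assumes "N \<le> fls_subdegree f" "M \<le> fls_subdegree g"
  shows "(f * g) $$ n = (\<Sum>i=N..n - M. f $$ i * g $$ (n - i))"
  unfolding fls_times_nth(2)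
proof (rule sum.mono_neutral_left)
  show "\<forall>i\<in>{N..n - M} - {fls_subdegree f..n - fls_subdegree g}. f $$ i * g $$ (n - i) = 0"
  proof
    fix i assume "i \<in> {N..n - M} - {fls_subdegree f..n - fls_subdegree g}"
    hence "i < fls_subdegree f \<or> n - i < fls_subdegree g" by auto
    thus "f $$ i * g $$ (n - i) = 0" by auto
  qed
qed (use assms in auto)

lemma derivation_fls_map:
  fixes d :: "'a::idom \<Rightarrow> 'a"
  assumes "derivation d"
  shows "derivation (fls_map d)"
proof
  interpret derivation d by fact
  note nth = fls_map_nth[of d, OF zero]
  have sumd: "d (\<Sum>i\<in>A. F i) = (\<Sum>i\<in>A. d (F i))" for A :: "int set" and F
    by (induction A rule: infinite_finite_induct) (simp_all add: zero add)
  fix f g :: "'a fls"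
  show "fls_map d (f + g) = fls_map d f + fls_map d g"
    by (rule fls_eqI) (simp add: nth add)
  show "fls_map d (f * g) = fls_map d f * g + f * fls_map d g"
  proof (rule fls_eqI)
    fix n
    define N where "N = min (fls_subdegree f) (fls_subdegree (fls_map d f))"
    define M where "M = min (fls_subdegree g) (fls_subdegree (fls_map d g))"
    note bounds = fls_times_nth_bounds[of N _ M]
    show "fls_map d (f * g) $$ n = (fls_map d f * g + f * fls_map d g) $$ n"
      by (simp add: bounds N_def M_def nth sumd mult sum.distrib)
  qed
qed

lemma fls_map_const: "h 0 = 0 \<Longrightarrow> fls_map h (fls_const c) = fls_const (h c)"
  by (rule fls_eqI) (simp add: fls_map_nth)

lemma fls_map_X: "derivation d \<Longrightarrow> fls_map d fls_X = 0"
  by (rule fls_eqI) (simp add: fls_map_nth derivation.zero derivation.one)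

lemma derivation_fls_deriv: "derivation (fls_deriv :: 'a::comm_ring_1 fls \<Rightarrow> _)"
  by standard simp_all

lemma fls_deriv_fls_map:
  fixes d :: "'a::comm_ring_1 \<Rightarrow> 'a"
  assumes "derivation d"
  shows "fls_deriv (fls_map d f) = fls_map d (fls_deriv f)"
proof -
  interpret derivation d by fact
  have "d (of_int n * c) = of_int n * d c" for n c by (simp add: mult of_int)
  from this[of "n + 1" for n] show ?thesis
    by (intro fls_eqI) (simp add: fls_map_nth zero)
qed

text \<open>
  The coefficient of \<open>z\<^sup>n\<close> in the equation expresses \<open>n + 1\<close> times the coefficient \<open>f\<^sub>n\<^sub>+\<^sub>1\<close> as
  \<open>d f\<^sub>n\<close>, so the constant term determines the solution.
\<close>

lemma fls_evolution_unique:
  fixes f :: "'a::{idom,ring_char_0} fps"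
  assumes "derivation d" "fls_deriv (fps_to_fls f) = fls_map d (fps_to_fls f)" "f $ 0 = 0"
  shows "f = 0"
proof -
  interpret derivation d by fact
  have "f $ n = 0" for n
  proof (induction n)
    case (Suc n)
    have "fls_deriv (fps_to_fls f) $$ int n = d (f $ n)"
      unfolding assms(2) by (simp add: fls_map_nth zero)
    hence "of_nat (Suc n) * f $ Suc n = 0" by (simp add: Suc zero add.commute nat_add_distrib)
    thus ?case using of_nat_neq_0[of n] by (simp only: mult_eq_0_iff) auto
  qed (fact assms(3))
  thus ?thesis by (simp add: fps_eq_iff)
qed

lemma ring_map_fps_to_fls: "ring_map (fps_to_fls :: 'a::comm_ring_1 fps \<Rightarrow> _)"
  by standard (simp_all add: fls_times_fps_to_fls)

definition constL :: "real \<Rightarrow> ratfun2 fls" where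
  "constL c = fls_const (const2 c)"

lemma ring_map_fls_const: "ring_map (fls_const :: 'a::comm_ring_1 \<Rightarrow> _)"
  by standard (simp_all add: fls_plus_const)

lemma ring_map_constL: "ring_map constL"
  unfolding constL_def by (rule ring_map_comp[OF ring_map_fls_const ring_map_const2])

lemma ring_map_fps_const: "ring_map (fps_const :: 'a::comm_ring_1 \<Rightarrow> _)"
  by standard simp_all

lemma ring_map_fps_nth_0: "ring_map (\<lambda>f :: 'a::comm_ring_1 fps. f $ 0)"
  by standard simp_all

text \<open>
  Setting \<open>z = 0\<close> in \<open>p(a, b)\<close> gives \<open>p(x, y)\<close>, which is nonzero for a nonzero polynomial. So
  denominators become units of the ring of power series.
\<close>

lemma ratfun_subst_fps:
  fixes f :: ratfun2
  assumes "a $ 0 = x2" "b $ 0 = y2"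
  shows "alg_independent constL (fps_to_fls a) (fps_to_fls b)"
    and "\<exists>g. ratfun_subst constL f (fps_to_fls a) (fps_to_fls b) = fps_to_fls g \<and> g $ 0 = f"
proof -
  define ev where "ev p = poly2_eval (\<lambda>c. fps_const (const2 c)) p a b" for p
  have ring: "ring_map (\<lambda>c. fps_const (const2 c))"
    by (rule ring_map_comp[OF ring_map_fps_const ring_map_const2])
  have ev_fls: "poly2_eval constL p (fps_to_fls a) (fps_to_fls b) = fps_to_fls (ev p)" for p
    unfolding ev_def ring_map_poly2_eval_image[OF ring_map_fps_to_fls ring]
    by (simp add: constL_def[abs_def])
  have ev_0: "ev p $ 0 = to_fract p" for p
    unfolding ev_def ring_map_poly2_eval_image[OF ring_map_fps_nth_0 ring]
    using assms by (simp add: poly2_eval_const2_x2_y2)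
  have nz: "ev p $ 0 \<noteq> 0" if "p \<noteq> 0" for p using that by (simp add: ev_0)
  show indep: "alg_independent constL (fps_to_fls a) (fps_to_fls b)"
    unfolding alg_independent_def ev_fls using nz by force
  obtain p q where f: "f = Fract p q" and q: "q \<noteq> 0" by (rule fract_cases)
  have "ratfun_subst constL f (fps_to_fls a) (fps_to_fls b) = fps_to_fls (ev p) / fps_to_fls (ev q)"
    unfolding f by (simp add: ratfun_subst_Fract[OF ring_map_constL indep q] ev_fls)
  also have "\<dots> = fps_to_fls (ev p * inverse (ev q))"
  proof -
    have "fps_to_fls (ev p * inverse (ev q)) * fps_to_fls (ev q) = fps_to_fls (ev p)"
      using inverse_mult_eq_1[OF nz[OF q]]
      by (simp add: mult.assoc flip: ring_map.mult[OF ring_map_fps_to_fls])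
    moreover have "fps_to_fls (ev q) \<noteq> 0" using nz[OF q] by auto
    ultimately show ?thesis by (simp add: nonzero_divide_eq_eq)
  qed
  finally have "ratfun_subst constL f (fps_to_fls a) (fps_to_fls b) = fps_to_fls (ev p * inverse (ev q))" .
  moreover have "(ev p * inverse (ev q)) $ 0 = f"
    by (simp add: ev_0 f Fract_conv_to_fract field_simps)
  ultimately show "\<exists>g. ratfun_subst constL f (fps_to_fls a) (fps_to_fls b) = fps_to_fls g \<and> g $ 0 = f"
    by blast
qed

definition expand :: "real poly poly poly \<Rightarrow> ratfun2 fls" where
  "expand p = fps_to_fls (fps_of_poly (map_poly to_fract p))"

lemma ring_map_fps_of_poly: "ring_map (fps_of_poly :: 'a::comm_ring_1 poly \<Rightarrow> _)"
  by standard (simp_all add: fps_of_poly_add fps_of_poly_mult)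

lemma ring_map_expand: "ring_map expand"
  unfolding expand_def
  by (intro ring_map_comp[OF ring_map_fps_to_fls] ring_map_comp[OF ring_map_fps_of_poly]
      ring_map_map_poly ring_map_to_fract)

lemma expand_eq_0_iff: "expand p = 0 \<longleftrightarrow> p = 0"
proof -
  have "expand p = 0 \<longleftrightarrow> fps_of_poly (map_poly to_fract p) = fps_of_poly 0"
    unfolding expand_def by simp
  also have "\<dots> \<longleftrightarrow> p = 0"
    unfolding fps_of_poly_eq_iff by (subst map_poly_eq_0_iff) auto
  finally show ?thesis .
qed

lemma expand_simps [simp]: "expand [:c:] = fls_const (to_fract c)" "expand [:0, 1:] = fls_X"
  by (simp_all add: expand_def map_poly_pCons map_poly_1 fps_of_poly_const)

definition expand3 :: "ratfun3 \<Rightarrow> ratfun2 fls" where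
  "expand3 = fract_extend expand"

lemma ring_map_expand3: "ring_map expand3"
  unfolding expand3_def by (rule ring_map_fract_extend[OF ring_map_expand]) (simp add: expand_eq_0_iff)

lemma expand3_simps:
  "expand3 (const3 c) = constL c" "expand3 x3 = fls_const x2" "expand3 y3 = fls_const y2"
  "expand3 z3 = fls_X"
  using fract_extend_to_fract[OF ring_map_expand]
  by (simp_all add: expand3_def const3_def x3_def y3_def z3_def expand_eq_0_iff constL_def
      const2_def x2_def y2_def)

text \<open>
  \<open>dilate p\<close> is \<open>p(x z, y z)\<close>, as a polynomial in \<open>z\<close>. It lists the homogeneous parts of \<open>p\<close>, and
  keeping it a polynomial permits to set \<open>z = 1\<close>, which is not possible for a Laurent series.
\<close>

definition dilate :: "real poly poly \<Rightarrow> real poly poly poly" where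
  "dilate p = poly2_eval (\<lambda>c. [:[:[:c:]:]:]) p [:0, [:[:0, 1:]:]:] [:0, [:0, 1:]:]"

lemma ring_map_const_poly3: "ring_map (\<lambda>c::real. [:[:[:c:]:]:])"
  by standard (simp_all add: one_pCons)

lemma ring_map_dilate: "ring_map dilate"
  unfolding dilate_def by (rule ring_map_poly2_eval[OF ring_map_const_poly3])

lemma dilate_simps [simp]:
  "dilate [:[:c:]:] = [:[:[:c:]:]:]" "dilate [:[:0, 1:]:] = [:0, [:[:0, 1:]:]:]"
  "dilate [:0, 1:] = [:0, [:0, 1:]:]"
  by (simp_all add: dilate_def ring_map_const_poly3)

lemma ring_map_poly_at: "ring_map (\<lambda>p. poly p a)"
  by standard simp_all

lemma ring_map_ident: "ring_map (\<lambda>a. a)"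
  by standard simp_all

lemma poly_dilate_1: "poly (dilate p) 1 = p"
  using poly2_ring_map_eqI[OF ring_map_comp[OF ring_map_poly_at ring_map_dilate] ring_map_ident, of 1 p]
  by simp

lemma poly2_eval_ray:
  "poly2_eval constL p (fls_const x2 * fls_X) (fls_const y2 * fls_X) = expand (dilate p)"
proof -
  have [simp]: "expand [:0, c:] = fls_const (to_fract c) * fls_X" for c
    using ring_map.mult[OF ring_map_expand, of "[:c:]" "[:0, 1:]"] by simp
  show ?thesis
    using ring_map_eq_poly2_eval[OF ring_map_constL ring_map_comp[OF ring_map_expand ring_map_dilate], of p]
    by (simp add: x2_def y2_def constL_def const2_def)
qed

lemma alg_independent_ray: "alg_independent constL (fls_const x2 * fls_X) (fls_const y2 * fls_X)"
  unfolding alg_independent_def poly2_eval_ray expand_eq_0_iff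
  by (metis poly_dilate_1 poly_0)

text \<open>
  The restriction \<open>f(x z, y z)\<close> of \<open>f\<close> to the line through the origin and the generic point \<open>(x, y)\<close>.
\<close>

definition ray :: "ratfun2 \<Rightarrow> ratfun2 fls" where
  "ray f = ratfun_subst constL f (fls_const x2 * fls_X) (fls_const y2 * fls_X)"

lemma ring_map_ray: "ring_map ray"
  unfolding ray_def by (rule ring_map_ratfun_subst[OF ring_map_constL alg_independent_ray])

lemma ray_x2: "ray x2 = fls_const x2 * fls_X" and ray_y2: "ray y2 = fls_const y2 * fls_X"
  by (simp_all add: ray_def ring_map_constL alg_independent_ray)

lemma ratfun_subst_constL_x2_y2:
  "ratfun_subst constL f (fls_const x2) (fls_const y2) = fls_const f"
  using ring_map_ratfun_subst_image(1)[OF ring_map_fls_const ring_map_const2, of f x2 y2]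
  by (simp add: ratfun_subst_const2_x2_y2 constL_def[abs_def])

definition euler :: "ratfun2 \<Rightarrow> ratfun2" where
  "euler f = x2 * dx f + y2 * dy f"

lemma euler_x2 [simp]: "euler x2 = x2" and euler_y2 [simp]: "euler y2 = y2"
  by (simp_all add: euler_def)

lemma derivation_euler: "derivation euler"
  by standard (simp_all add: euler_def derivation.add[OF derivation_dx] derivation.add[OF derivation_dy]
      derivation.mult[OF derivation_dx] derivation.mult[OF derivation_dy] algebra_simps)

text \<open>
  Along a line through the origin, the Euler derivation is the one in the line parameter.
\<close>

lemma fls_deriv_ray: "fls_X * fls_deriv (ray f) = ray (euler f)"
proof -
  interpret ray: ring_map ray by (rule ring_map_ray)
  have "fls_deriv (ray f) = ray (dx f) * fls_const x2 + ray (dy f) * fls_const y2"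
    using derivation_ratfun_subst[OF ring_map_constL derivation_fls_deriv _ alg_independent_ray, of f]
    by (simp add: ray_def constL_def)
  thus ?thesis by (simp add: euler_def ray.add ray.mult ray_x2 ray_y2 algebra_simps)
qed

lemma fls_map_ray:
  assumes "derivation d" "\<And>c. d (const2 c) = 0"
  shows "fls_map d (ray f) =
    fls_X * (fls_const (d x2) * ray (dx f) + fls_const (d y2) * ray (dy f))"
proof -
  interpret d: derivation "fls_map d" by (rule derivation_fls_map[OF assms(1)])
  have "fls_map d (constL c) = 0" for c
    by (simp add: constL_def fls_map_const derivation.zero[OF assms(1)] assms(2))
  from derivation_ratfun_subst[OF ring_map_constL d.derivation_axioms this alg_independent_ray, of f]
  show ?thesis
    by (simp add: ray_def d.mult fls_map_X[OF assms(1)] fls_map_const derivation.zero[OF assms(1)]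
        algebra_simps)
qed

text \<open>
  Euler's theorem on homogeneous functions. By the Euler equation \<open>f(x z, y z) / z\<^sup>2\<close> has derivative
  zero in \<open>z\<close>, so it is a constant \<open>c\<close> in \<open>\<real>(x,y)\<close>. With \<open>f = p / q\<close> this is the polynomial identity
  \<open>p(x z, y z) = c z\<^sup>2 q(x z, y z)\<close>. At \<open>z = 1\<close> it yields \<open>c = f\<close>; substituting \<open>a, b, k\<close> for
  \<open>x, y, z\<close> it yields the claim.
\<close>

lemma homogeneous_ratfun_subst:
  assumes f: "euler f = 2 * f" and \<iota>: "ring_map \<iota>"
    and indep: "alg_independent \<iota> a b" "alg_independent \<iota> (k * a) (k * b)"
  shows "ratfun_subst \<iota> f (k * a) (k * b) = k ^ 2 * ratfun_subst \<iota> f a b"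
proof -
  interpret ray: ring_map ray by (rule ring_map_ray)
  obtain p q where pq: "f = Fract p q" and q: "q \<noteq> 0" by (rule fract_cases)
  have "fls_X * fls_deriv (ray f) = 2 * ray f"
    unfolding fls_deriv_ray f by (simp only: mult_2 ray.add)
  hence num: "fls_deriv (ray f) * fls_X ^ 2 - ray f * fls_deriv (fls_X ^ 2) = 0"
    by (simp add: power2_eq_square algebra_simps)
  have "fls_deriv (ray f / fls_X ^ 2) = 0"
    by (subst derivation_divide[OF derivation_fls_deriv]) (simp_all only: num, simp_all)
  then obtain c where "ray f / fls_X ^ 2 = fls_const c"
    using fls_deriv_eq_0_iff by metis
  hence "ray f = fls_const c * fls_X ^ 2"
    using nonzero_divide_eq_eq[of "fls_X ^ 2 :: ratfun2 fls"] by (metis fls_X_nonzero power_not_zero)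
  hence "expand (dilate p) = fls_const c * fls_X ^ 2 * expand (dilate q)"
    using alg_independent_nonzero[OF alg_independent_ray q]
    unfolding pq ray_def ratfun_subst_Fract[OF ring_map_constL alg_independent_ray q] poly2_eval_ray
    by (simp add: field_simps)
  also have "fls_const c * fls_X ^ 2 = fps_to_fls (fps_of_poly (monom c 2))"
    by (simp add: fps_of_poly_monom fls_times_fps_to_fls fps_to_fls_power)
  finally have eq: "map_poly to_fract (dilate p) = monom c 2 * map_poly to_fract (dilate q)"
    unfolding expand_def
    by (simp add: fps_of_poly_eq_iff flip: fls_times_fps_to_fls fps_of_poly_mult)
  have sub: "poly (map_poly h (map_poly to_fract (dilate p))) l
      = poly2_eval \<kappa> p (l * h x2) (l * h y2)"
    if "ring_map h" "ring_map \<kappa>" "\<And>c. h (const2 c) = \<kappa> c"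
    for h :: "ratfun2 \<Rightarrow> 'b::field" and \<kappa> p l
  proof -
    interpret h: ring_map h by fact
    have "ring_map (\<lambda>p. poly (map_poly h (map_poly to_fract (dilate p))) l)"
      by (intro ring_map_comp[OF ring_map_poly] ring_map_comp[OF ring_map_map_poly] ring_map_dilate
          ring_map_to_fract that)
    from ring_map_eq_poly2_eval[OF that(2) this, of p] show ?thesis
      by (simp add: map_poly_pCons that(3)[unfolded const2_def] x2_def y2_def h.zero)
  qed
  have "to_fract p = c * to_fract q"
    using sub[OF ring_map_ident ring_map_const2, of p 1] sub[OF ring_map_ident ring_map_const2, of q 1]
    by (simp add: eq poly_monom poly2_eval_const2_x2_y2)
  hence c: "c = f" using q by (simp add: pq Fract_conv_to_fract)
  interpret h: ring_map "\<lambda>f. ratfun_subst \<iota> f a b" by (rule ring_map_ratfun_subst[OF \<iota> indep(1)])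
  interpret P: ring_map "map_poly (\<lambda>f. ratfun_subst \<iota> f a b)"
    by (rule ring_map_map_poly[OF h.ring_map_axioms])
  have "ratfun_subst \<iota> (const2 c) a b = \<iota> c" for c
    by (simp add: const2_def ratfun_subst_to_fract[OF \<iota> indep(1)] \<iota>)
  note sub' = sub[OF h.ring_map_axioms \<iota> this, of _ k, unfolded ratfun_subst_x2[OF \<iota> indep(1)]
      ratfun_subst_y2[OF \<iota> indep(1)]]
  have "poly2_eval \<iota> p (k * a) (k * b) =
      ratfun_subst \<iota> f a b * k ^ 2 * poly2_eval \<iota> q (k * a) (k * b)"
    by (simp add: eq P.mult map_poly_monom h.zero poly_monom c flip: sub')
  thus ?thesis
    using alg_independent_nonzero[OF indep(2) q]
    unfolding pq ratfun_subst_Fract[OF \<iota> indep(2) q] by simp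
qed


section \<open>The boundary condition\<close>

lemma ring_map_id: "ring_map (id :: 'a::comm_ring_1 \<Rightarrow> _)"
  by standard simp_all

lemma exists_nonzero_point:
  assumes "p \<noteq> (0 :: real poly poly)"
  shows "\<exists>a b. poly2_eval id p a b \<noteq> 0"
proof -
  have inf: "\<exists>a. poly c a \<noteq> 0" if "c \<noteq> 0" for c :: "real poly"
    using that poly_all_0_iff_0 by blast
  obtain a where a: "poly (lead_coeff p) a \<noteq> 0" using inf[of "lead_coeff p"] assms by auto
  have "coeff (map_poly (\<lambda>c. poly (map_poly id c) a) p) (degree p) \<noteq> 0"
    using a by (simp add: coeff_map_poly)
  hence "map_poly (\<lambda>c. poly (map_poly id c) a) p \<noteq> 0" by (metis coeff_0)
  thus ?thesis unfolding poly2_eval_def using inf by blast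
qed

lemma order_factorization:
  fixes p :: "'a::idom poly"
  assumes "p \<noteq> 0"
  obtains n q where "p = [:0, 1:] ^ n * q" "poly q 0 \<noteq> 0"
  using order_decomp[OF assms, of 0] that by (auto simp: poly_eq_0_iff_dvd)

text \<open>
  Write \<open>u = p / q\<close>, let \<open>n\<close> be the order in \<open>z\<close> of \<open>q(x z, y z)\<close>, and let
  \<open>R = p(x z, y z) - z l(x, y) q(x z, y z)\<close>. If the order \<open>k\<close> of \<open>R\<close> were at most \<open>n + 1\<close>, there would be a real
  point at which the limit exists and the lowest coefficients of \<open>R\<close> and of \<open>q(x z, y z)\<close> do not vanish.
  At this point \<open>R / (z q(x z, y z))\<close> would be asymptotic to a nonzero multiple of
  \<open>z\<close> to the power \<open>k - n - 1 \<le> 0\<close>, although the limit says that it tends to \<open>0\<close>. So \<open>R\<close> is divisible by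
  \<open>z\<close> to the power \<open>n + 2\<close>, that is, \<open>u(x z, y z) / z\<close> is \<open>l(x, y)\<close> up to terms of positive order.
\<close>

lemma ray_of_limit:
  fixes D l :: "real poly poly"
  assumes D: "D \<noteq> 0"
    and lim: "\<And>a b. poly2_eval id D a b \<noteq> 0 \<Longrightarrow>
      ((\<lambda>t. ratfun_subst id u (a * t) (b * t) / t) \<longlongrightarrow> poly2_eval id l a b) (at 0)"
  shows "\<exists>g. ray u = fls_X * fps_to_fls g \<and> g $ 0 = to_fract l"
proof -
  define p where "p = fst (quot_of_fract u)"
  define q where "q = snd (quot_of_fract u)"
  have q: "q \<noteq> 0" by (simp add: q_def)
  have u: "u = Fract p q" by (simp add: p_def q_def)
  interpret expand: ring_map expand by (rule ring_map_expand)
  define R where "R = dilate p - [:0, l:] * dilate q"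
  have "dilate q \<noteq> 0" using poly_dilate_1[of q] q by auto
  then obtain n Q where Q: "dilate q = [:0, 1:] ^ n * Q" "poly Q 0 \<noteq> 0"
    by (rule order_factorization)
  have "\<exists>R'. R = [:0, 1:] ^ (n + 2) * R'"
  proof (cases "R = 0")
    case False
    then obtain k R' where R': "R = [:0, 1:] ^ k * R'" "poly R' 0 \<noteq> 0"
      by (rule order_factorization)
    have "n + 2 \<le> k"
    proof (rule ccontr)
      assume "\<not> n + 2 \<le> k"
      hence k: "k \<le> n + 1" by simp
      obtain a b where "poly2_eval id (D * poly R' 0 * poly Q 0) a b \<noteq> 0"
        using exists_nonzero_point[of "D * poly R' 0 * poly Q 0"] D R'(2) Q(2) by auto
      hence ab: "poly2_eval id D a b \<noteq> 0" "poly2_eval id (poly R' 0) a b \<noteq> 0"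
          "poly2_eval id (poly Q 0) a b \<noteq> 0"
        by (simp_all add: ring_map.mult[OF ring_map_poly2_eval[OF ring_map_id]])
      \<comment> \<open>specialisation of the coefficients in \<open>\<real>[x,y]\<close> at the point \<open>(a, b)\<close>\<close>
      define sp where "sp F = map_poly (\<lambda>c. poly2_eval id c a b) F" for F
      have ring: "ring_map (\<lambda>c. poly2_eval id c a b)" by (rule ring_map_poly2_eval[OF ring_map_id])
      interpret sp: ring_map sp unfolding sp_def by (rule ring_map_map_poly[OF ring])
      have sp_0: "poly (sp F) 0 = poly2_eval id (poly F 0) a b" for F
        by (simp add: sp_def poly_0_coeff_0 coeff_map_poly ring_map.zero[OF ring])
      have sp_simps: "sp [:0, c:] = [:0, poly2_eval id c a b:]" for c
        by (simp add: sp_def map_poly_pCons ring_map.zero[OF ring])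
      have sp_X: "sp [:0, 1:] = [:0, 1:]" by (simp add: sp_simps ring_map.one[OF ring])
      have sp_dilate: "poly (sp (dilate r)) t = poly2_eval id r (a * t) (b * t)" for r t
        using ring_map_eq_poly2_eval[OF ring_map_id
            ring_map_comp[OF ring_map_poly_at ring_map_comp[OF sp.ring_map_axioms ring_map_dilate]], of t r]
        by (simp add: sp_simps) (simp add: sp_def map_poly_pCons ring_map.zero[OF ring] ring_map_id
            mult.commute)
      define lab where "lab = poly2_eval id l a b"
      \<comment> \<open>the factors clear the denominator, so that \<open>F\<close> agrees with the polynomial \<open>sp R'\<close> near \<open>0\<close>\<close>
      define F where "F t = (ratfun_subst id u (a * t) (b * t) / t - lab) * poly (sp Q) t * t ^ (n + 1 - k)"
        for t
      have "eventually (\<lambda>t. poly (sp Q) t \<noteq> 0) (at 0)"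
        using poly_isCont[of 0 "sp Q"] ab(3)
        by (intro tendsto_imp_eventually_ne[of _ "poly (sp Q) 0"]) (simp_all add: isCont_def sp_0)
      moreover have "eventually (\<lambda>t. t \<noteq> (0::real)) (at 0)"
        by (simp add: eventually_at_filter)
      ultimately have "eventually (\<lambda>t. F t = poly (sp R') t) (at 0)"
      proof eventually_elim
        case (elim t)
        have Qt: "poly2_eval id q (a * t) (b * t) = t ^ n * poly (sp Q) t"
          by (simp add: Q(1) sp.mult sp.power sp_X flip: sp_dilate)
        have Rt: "poly2_eval id p (a * t) (b * t) - t * lab * poly2_eval id q (a * t) (b * t)
            = t ^ k * poly (sp R') t"
          using arg_cong[OF R'(1), of "\<lambda>F. poly (sp F) t"]
          unfolding R_def sp.diff sp.mult sp.power sp_simps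
          by (simp add: sp_dilate lab_def ring_map.one[OF ring])
        have "ratfun_subst id u (a * t) (b * t) / t - lab =
            (poly2_eval id p (a * t) (b * t) - t * lab * poly2_eval id q (a * t) (b * t))
            / (t * poly2_eval id q (a * t) (b * t))"
          using elim by (simp add: ratfun_subst_def Qt flip: p_def q_def) (simp add: field_simps)
        also have "\<dots> = t ^ k * poly (sp R') t / (t ^ (n + 1) * poly (sp Q) t)"
          unfolding Rt unfolding Qt by (simp add: mult_ac)
        also have "t ^ (n + 1) = t ^ k * t ^ (n + 1 - k)"
          using k by (simp flip: power_add)
        finally show ?case unfolding F_def using elim by (simp only:) simp
      qed
      moreover have "(F \<longlongrightarrow> 0 * poly (sp Q) 0 * 0 ^ (n + 1 - k)) (at 0)"
        unfolding F_def using lim[OF ab(1)] unfolding lab_def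
        by (intro tendsto_mult tendsto_power LIM_zero) (auto intro!: tendsto_intros)
      ultimately have "((\<lambda>t. poly (sp R') t) \<longlongrightarrow> 0) (at 0)"
        by (simp add: tendsto_cong)
      moreover have "((\<lambda>t. poly (sp R') t) \<longlongrightarrow> poly (sp R') 0) (at 0)"
        by (auto intro!: tendsto_intros)
      ultimately have "poly (sp R') 0 = 0" using LIM_unique by blast
      thus False using ab(2) by (simp add: sp_0)
    qed
    hence "R = [:0, 1:] ^ (n + 2) * ([:0, 1:] ^ (k - (n + 2)) * R')"
      by (simp only: R'(1) le_add_diff_inverse flip: mult.assoc power_add)
    thus ?thesis by blast
  qed auto
  then obtain R' where R': "R = [:0, 1:] ^ (n + 2) * R'" by blast
  define r where "r = fps_of_poly (map_poly to_fract R')"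
  define s where "s = fps_of_poly (map_poly to_fract Q)"
  have rs: "expand R' = fps_to_fls r" "expand Q = fps_to_fls s"
    by (simp_all add: r_def s_def expand_def)
  have s0: "s $ 0 \<noteq> 0" using Q(2) by (simp add: s_def coeff_map_poly poly_0_coeff_0)
  have inv: "fps_to_fls (inverse s) * fps_to_fls s = 1"
    using inverse_mult_eq_1[OF s0] by (simp flip: fls_times_fps_to_fls)
  define g where "g = fps_const (to_fract l) + fps_X * r * inverse s"
  have "ray u * expand (dilate q) = expand (dilate p)"
    using alg_independent_nonzero[OF alg_independent_ray q]
    unfolding u ray_def ratfun_subst_Fract[OF ring_map_constL alg_independent_ray q] poly2_eval_ray
    by simp
  also have "dilate p = R + [:0, 1:] * [:l:] * dilate q" by (simp add: R_def)
  also have "expand \<dots> = fls_X * fps_to_fls g * expand (dilate q)"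
  proof -
    have "expand (dilate q) = fls_X ^ n * fps_to_fls s"
      by (simp only: Q(1) expand.mult expand.power expand_simps rs)
    moreover have "expand R = fls_X ^ (n + 2) * (fps_to_fls r * (fps_to_fls (inverse s) * fps_to_fls s))"
      by (simp only: R' expand.mult expand.power expand_simps rs inv mult_1_right)
    ultimately show ?thesis
      by (simp only: g_def expand.add expand.mult expand_simps fps_to_fls_plus fls_times_fps_to_fls
          fps_X_to_fls fps_const_to_fls power_add power2_eq_square distrib_left distrib_right mult_ac
          add_ac)
  qed
  finally have "ray u = fls_X * fps_to_fls g"
    using alg_independent_nonzero[OF alg_independent_ray q] by (simp add: poly2_eval_ray)
  moreover have "g $ 0 = to_fract l" by (simp add: g_def)
  ultimately show ?thesis by blast
qed

lemma boundary_condition_ray: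
  assumes "boundary_condition u v"
  obtains U W where "ray u = fls_X * fps_to_fls U" "ray v = fls_X * fps_to_fls W"
    "U $ 0 = x2" "W $ 0 = y2"
proof -
  obtain D where D: "D \<noteq> 0" and lim:
    "\<And>a b. poly2_eval id D a b \<noteq> 0 \<Longrightarrow>
       ((\<lambda>t. ratfun_subst id u (a * t) (b * t) / t) \<longlongrightarrow> a) (at 0)"
    "\<And>a b. poly2_eval id D a b \<noteq> 0 \<Longrightarrow>
       ((\<lambda>t. ratfun_subst id v (a * t) (b * t) / t) \<longlongrightarrow> b) (at 0)"
    using assms unfolding boundary_condition_def by blast
  show ?thesis
    using ray_of_limit[OF D, of u "[:[:0, 1:]:]"] ray_of_limit[OF D, of v "[:0, 1:]"] lim that
    by (auto simp: ring_map_id x2_def y2_def)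
qed


section \<open>Quadratic vector fields generating the flow\<close>

text \<open>
  The pivot between the two sides of the theorem. For \<open>\<phi> = (u, v)\<close> the family
  \<open>\<phi>\<^sup>t(\<^bold>x) = \<phi>(\<^bold>x t) / t\<close> is a flow with vector field \<open>(P, Q)\<close> only if transporting the
  field by \<open>\<phi>\<close> gives the time derivative of the flow at \<open>t = 1\<close>, and the latter is
  \<open>\<phi>\<close> acted upon by \<open>euler - 1\<close>. The scaling in the definition of \<open>\<phi>\<^sup>t\<close> forces \<open>P\<close> and \<open>Q\<close> to be
  homogeneous of degree 2, which is what the first two equations say by Euler's theorem.
\<close>

definition quadratic_generator :: "ratfun2 \<Rightarrow> ratfun2 \<Rightarrow> ratfun2 \<Rightarrow> ratfun2 \<Rightarrow> bool" where
  "quadratic_generator u v P Q \<longleftrightarrow> euler P = 2 * P \<and> euler Q = 2 * Q \<and>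
     (\<forall>f\<in>{u, v}. P * dx f + Q * dy f = euler f - f)"

lemma projective_pde_system_iff:
  "projective_pde_system u v \<longleftrightarrow> (\<forall>f\<in>{u, v}.
     euler (dx f) * (v * dy u - u * dy v) + euler (dy f) * (u * dx v - v * dx u)
     = 2 * (f - euler f) * (dx u * dy v - dy u * dx v))"
  by (auto simp: projective_pde_system_def euler_def dx_dy_commute algebra_simps)

lemma cramer:
  fixes a b c d X Y :: "'a::comm_ring_1"
  assumes "a * X + b * Y = r" "c * X + d * Y = s"
  shows "X * (a * d - b * c) = d * r - b * s" "Y * (a * d - b * c) = a * s - c * r"
  unfolding assms[symmetric] by (simp_all add: algebra_simps)

text \<open>
  In terms of \<open>A = P - x\<close> and \<open>B = Q - y\<close> the generator equations read \<open>f\<^sub>x A + f\<^sub>y B = - f\<close>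
  for \<open>f = u, v\<close>. Applying the Euler derivation and using \<open>euler A = 2 A + x\<close>,
  \<open>euler B = 2 B + y\<close> leaves \<open>(euler f\<^sub>x) A + (euler f\<^sub>y) B = 2 (f - euler f)\<close>. By Cramer's rule
  \<open>A\<close> and \<open>B\<close> times the Jacobian are the two brackets of the system, so multiplying by the
  Jacobian gives the system.
\<close>

lemma quadratic_generator_imp_pde_system:
  assumes "quadratic_generator u v P Q"
  shows "projective_pde_system u v"
proof -
  interpret E: derivation euler by (rule derivation_euler)
  define A where "A = P - x2"
  define B where "B = Q - y2"
  have EAB: "euler A = 2 * A + x2" "euler B = 2 * B + y2"
    using assms by (simp_all add: quadratic_generator_def A_def B_def E.diff)
  have lin: "dx f * A + dy f * B = - f" if f: "f \<in> {u, v}" for f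
  proof -
    have "P * dx f + Q * dy f = euler f - f"
      using assms f unfolding quadratic_generator_def by blast
    thus ?thesis by (simp add: A_def B_def euler_def[of f] algebra_simps)
  qed
  have second: "euler (dx f) * A + euler (dy f) * B = 2 * (f - euler f)" if f: "f \<in> {u, v}" for f
  proof -
    have "euler (dx f * A + dy f * B) = - euler f" by (simp add: lin[OF f] E.minus)
    hence "euler (dx f) * A + euler (dy f) * B + 2 * (dx f * A + dy f * B) + euler f = - euler f"
      by (simp add: E.add E.mult EAB euler_def[of f] algebra_simps)
    thus ?thesis unfolding lin[OF f] by (simp add: algebra_simps)
  qed
  define J where "J = dx u * dy v - dy u * dx v"
  have "A * J = v * dy u - u * dy v" "B * J = u * dx v - v * dx u"
    using cramer[OF lin[of u] lin[of v]] by (simp_all add: J_def mult.commute)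
  thus ?thesis
    unfolding projective_pde_system_iff J_def[symmetric] using second
    by (metis (no_types, lifting) distrib_right mult.assoc)
qed

text \<open>
  Conversely, if the Jacobian \<open>J\<close> is invertible, Cramer's rule defines \<open>A\<close> and \<open>B\<close> by the
  linear equations. Comparing the system with the Euler derivative of these equations shows that
  \<open>(euler A - 2 A - x, euler B - 2 B - y)\<close> solves the homogeneous linear system, hence vanishes.
\<close>

lemma pde_system_imp_quadratic_generator:
  assumes pde: "projective_pde_system u v" and "dx u * dy v - dy u * dx v \<noteq> 0"
  obtains P Q where "quadratic_generator u v P Q"
proof -
  interpret E: derivation euler by (rule derivation_euler)
  define J where "J = dx u * dy v - dy u * dx v"
  have J: "J \<noteq> 0" unfolding J_def by (rule assms(2))
  define A where "A = (v * dy u - u * dy v) / J"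
  define B where "B = (u * dx v - v * dx u) / J"
  have AJ: "v * dy u - u * dy v = A * J" and BJ: "u * dx v - v * dx u = B * J"
    using J by (simp_all add: A_def B_def)
  have lin: "dx f * A + dy f * B = - f" if f: "f \<in> {u, v}" for f
  proof -
    have "(dx f * A + dy f * B) * J = - f * J"
      unfolding distrib_right mult.assoc AJ[symmetric] BJ[symmetric]
      using f by (auto simp: J_def algebra_simps)
    thus ?thesis by (rule mult_right_cancel[OF J, THEN iffD1])
  qed
  have second: "euler (dx f) * A + euler (dy f) * B = 2 * (f - euler f)" if f: "f \<in> {u, v}" for f
  proof -
    have "euler (dx f) * (A * J) + euler (dy f) * (B * J) = 2 * (f - euler f) * J"
      using pde f unfolding projective_pde_system_iff AJ BJ J_def[symmetric] by blast
    hence "(euler (dx f) * A + euler (dy f) * B) * J = 2 * (f - euler f) * J"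
      by (simp only: distrib_right mult.assoc)
    thus ?thesis by (rule mult_right_cancel[OF J, THEN iffD1])
  qed
  have third: "dx f * (euler A - 2 * A - x2) + dy f * (euler B - 2 * B - y2) = 0"
    if f: "f \<in> {u, v}" for f
  proof -
    have "euler (dx f * A + dy f * B) = - euler f" by (simp add: lin[OF f] E.minus)
    hence "dx f * euler A + dy f * euler B = - euler f - 2 * (f - euler f)"
      unfolding second[OF f, symmetric] by (simp add: E.add E.mult algebra_simps)
    also have "\<dots> = euler f + 2 * (dx f * A + dy f * B)" unfolding lin[OF f] by simp
    finally show ?thesis by (simp add: euler_def[of f] algebra_simps)
  qed
  have "(euler A - 2 * A - x2) * J = 0" "(euler B - 2 * B - y2) * J = 0"
    using cramer[OF third[of u] third[of v]] by (simp_all add: J_def)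
  hence "euler A - 2 * A - x2 = 0" "euler B - 2 * B - y2 = 0" using J by simp_all
  hence EAB: "euler A = 2 * A + x2" "euler B = 2 * B + y2" by (simp_all add: diff_eq_eq)
  have "(A + x2) * dx f + (B + y2) * dy f = euler f - f" if "f \<in> {u, v}" for f
    using lin[OF that] by (simp add: euler_def algebra_simps)
  hence "quadratic_generator u v (A + x2) (B + y2)"
    unfolding quadratic_generator_def by (simp add: E.add EAB)
  thus ?thesis by (rule that)
qed


section \<open>From the translation equation to a generator\<close>

text \<open>
  The translation equation moves into the field of Laurent series, where \<open>z\<close> is the series
  variable. Both arguments of the outer substitution are power series with constant terms \<open>x\<close>
  and \<open>y\<close>, so that substitution always makes sense.
\<close>

lemma projective_translation_equation_expand:
  fixes U W :: "ratfun2 fps"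
  assumes "ray u = fls_X * fps_to_fls U" "ray v = fls_X * fps_to_fls W" "U $ 0 = x2" "W $ 0 = y2"
  defines "a \<equiv> (1 - fls_X) * fps_to_fls U" and "b \<equiv> (1 - fls_X) * fps_to_fls W"
  shows "projective_translation_equation u v \<longleftrightarrow>
    ratfun_subst constL u a b = (1 - fls_X) * fls_const u \<and>
    ratfun_subst constL v a b = (1 - fls_X) * fls_const v"
proof -
  interpret h: ring_map expand3 by (rule ring_map_expand3)
  have const3: "ring_map const3"
    by standard (simp_all add: const3_def flip: one_pCons to_fract_add to_fract_mult)
  have constL: "(\<lambda>c. expand3 (const3 c)) = constL" by (simp add: expand3_simps)
  note subst = ring_map_ratfun_subst_image[OF h.ring_map_axioms const3, unfolded constL]
  have inj: "expand3 f = expand3 g \<longleftrightarrow> f = g" for f g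
    using ring_map_inj[OF h.ring_map_axioms] by blast
  define a3 where "a3 = ratfun_subst const3 u (x3 * z3) (y3 * z3) * ((1 - z3) / z3)"
  define b3 where "b3 = ratfun_subst const3 v (x3 * z3) (y3 * z3) * ((1 - z3) / z3)"
  have cancel: "k * F * (c / k) = c * F" if "k \<noteq> 0" for k F c :: "ratfun2 fls"
    using that by simp
  have a: "expand3 a3 = a" and b: "expand3 b3 = b"
    unfolding a3_def b3_def a_def b_def h.mult subst ring_map_divide[OF h.ring_map_axioms]
      h.diff h.one expand3_simps ray_def[symmetric] assms(1,2)
    by (simp_all only: cancel[OF fls_X_nonzero])
  have "alg_independent constL (fps_to_fls ((1 - fps_X) * U)) (fps_to_fls ((1 - fps_X) * W))"
    by (rule ratfun_subst_fps(1)) (simp_all add: assms)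
  hence indep: "alg_independent constL a b" by (simp add: a_def b_def fls_times_fps_to_fls)
  show ?thesis
    unfolding projective_translation_equation_def Let_def a3_def[symmetric] b3_def[symmetric]
      subst(2) inj[symmetric] h.mult h.diff h.one subst(1) a b expand3_simps
      ratfun_subst_constL_x2_y2
    using ratfun_subst_defined[OF ring_map_constL indep] by auto
qed

text \<open>
  The generator is the linear term of \<open>\<phi>(\<^bold>x z) / z\<close> in \<open>z\<close>. Its equations are the derivative of
  the translation equation with respect to \<open>z\<close> at \<open>z = 0\<close>. It is homogeneous of degree 2 because
  on \<open>f(\<^bold>x z)\<close> the Euler derivation in \<open>\<^bold>x\<close> agrees with the one in \<open>z\<close>, whose eigenspaces are the
  homogeneous terms in \<open>z\<close>.
\<close>

lemma translation_equation_imp_quadratic_generator: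
  assumes "projective_translation_equation u v" and bc: "boundary_condition u v"
  obtains P Q where "quadratic_generator u v P Q"
proof -
  from bc obtain U W where UW: "ray u = fls_X * fps_to_fls U" "ray v = fls_X * fps_to_fls W"
    "U $ 0 = x2" "W $ 0 = y2" by (rule boundary_condition_ray)
  define a where "a = (1 - fps_X) * U"
  define b where "b = (1 - fps_X) * W"
  have ab: "fps_to_fls a = (1 - fls_X) * fps_to_fls U" "fps_to_fls b = (1 - fls_X) * fps_to_fls W"
    by (simp_all add: a_def b_def fls_times_fps_to_fls)
  have ab0: "a $ 0 = x2" "b $ 0 = y2" by (simp_all add: a_def b_def UW)
  note indep = ratfun_subst_fps(1)[OF ab0]
  have eq: "ratfun_subst constL f (fps_to_fls a) (fps_to_fls b) = (1 - fls_X) * fls_const f"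
    if "f \<in> {u, v}" for f
    using assms(1) that unfolding projective_translation_equation_expand[OF UW] ab by auto
  define P where "P = fps_nth U 1"
  define Q where "Q = fps_nth W 1"
  \<comment> \<open>the shift by \<open>- x\<close>, \<open>- y\<close> comes from differentiating the factor \<open>1 - z\<close>\<close>
  have deriv_ab: "fps_deriv a $ 0 = P - x2" "fps_deriv b $ 0 = Q - y2"
    by (simp_all add: a_def b_def P_def Q_def UW ring_distribs)
  have lin: "P * dx f + Q * dy f = euler f - f" if f: "f \<in> {u, v}" for f
  proof -
    obtain g where g: "ratfun_subst constL (dx f) (fps_to_fls a) (fps_to_fls b) = fps_to_fls g"
      "g $ 0 = dx f" using ratfun_subst_fps(2)[OF ab0] by blast
    obtain h where h: "ratfun_subst constL (dy f) (fps_to_fls a) (fps_to_fls b) = fps_to_fls h"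
      "h $ 0 = dy f" using ratfun_subst_fps(2)[OF ab0] by blast
    have "fps_to_fls (g * fps_deriv a + h * fps_deriv b) = fls_deriv ((1 - fls_X) * fls_const f)"
      using derivation_ratfun_subst[OF ring_map_constL derivation_fls_deriv _ indep, of f]
      by (simp add: constL_def eq[OF f] g h fls_deriv_fps_to_fls fls_times_fps_to_fls)
    also have "\<dots> = fps_to_fls (- fps_const f)" by simp
    finally have "g * fps_deriv a + h * fps_deriv b = - fps_const f"
      by (simp only: fps_to_fls_eq_iff)
    from arg_cong[OF this, of "\<lambda>F. F $ 0"] have "dx f * (P - x2) + dy f * (Q - y2) = - f"
      using deriv_ab by (simp add: g h)
    thus ?thesis by (simp add: euler_def[of f] algebra_simps)
  qed
  have hom: "euler (fps_nth F 1) = 2 * fps_nth F 1" if "ray f = fls_X * fps_to_fls F" for f F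
  proof -
    have "fls_map euler (ray f) = ray (euler f)"
      using fls_map_ray[OF derivation_euler, of f] ring_map_ray
      by (simp add: euler_def[of "const2 _"] ray_x2 ray_y2 ring_map.add ring_map.mult euler_def[of f]
          algebra_simps)
    also have "\<dots> = fls_X * fls_deriv (ray f)" by (simp add: fls_deriv_ray)
    finally have "fls_map euler (ray f) $$ 2 = (fls_X * fls_deriv (ray f)) $$ 2" by simp
    thus ?thesis unfolding that
      by (simp add: fls_map_nth derivation.zero[OF derivation_euler] fls_X_times_conv_shift)
  qed
  have "quadratic_generator u v P Q"
    using lin hom[OF UW(1)] hom[OF UW(2)] by (simp add: quadratic_generator_def P_def Q_def)
  thus ?thesis by (rule that)
qed


section \<open>From a generator to the translation equation\<close>

lemma fls_map_ray_fps:
  assumes d: "derivation d" "\<And>c. d (const2 c) = 0" and F: "ray f = fls_X * fps_to_fls F"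
  shows "fls_map d (fps_to_fls F) = fls_const (d x2) * ray (dx f) + fls_const (d y2) * ray (dy f)"
proof -
  have "fls_X * fls_map d (fps_to_fls F) = fls_map d (ray f)"
    unfolding F derivation.mult[OF derivation_fls_map[OF d(1)]] fls_map_X[OF d(1)] by simp
  also have "\<dots> = fls_X * (fls_const (d x2) * ray (dx f) + fls_const (d y2) * ray (dy f))"
    by (rule fls_map_ray[OF d])
  finally show ?thesis by (metis fls_X_nonzero mult_left_cancel)
qed

text \<open>
  \<open>\<phi>(\<^bold>x z) / z\<close> has constant term \<open>\<^bold>x\<close>, so its Jacobian determinant with respect to \<open>\<^bold>x\<close>, which is
  the Jacobian determinant of \<open>\<phi>\<close> at \<open>\<^bold>x z\<close>, has constant term 1.
\<close>

lemma boundary_jacobian_nonzero: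
  assumes "ray u = fls_X * fps_to_fls U" "ray v = fls_X * fps_to_fls W" "U $ 0 = x2" "W $ 0 = y2"
  shows "dx u * dy v - dy u * dx v \<noteq> 0"
proof
  assume 0: "dx u * dy v - dy u * dx v = 0"
  interpret ray: ring_map ray by (rule ring_map_ray)
  define D where "D d F = Abs_fps (\<lambda>n. d (F $ n))" for d :: "ratfun2 \<Rightarrow> ratfun2" and F
  have D: "fls_map d (fps_to_fls F) = fps_to_fls (D d F)" if "derivation d" for d F
    by (rule fls_eqI) (simp add: fls_map_nth D_def derivation.zero[OF that])
  have x: "ray (dx f) = fps_to_fls (D dx F)" and y: "ray (dy f) = fps_to_fls (D dy F)"
    if "ray f = fls_X * fps_to_fls F" for f F
    using fls_map_ray_fps[OF derivation_dx _ that] fls_map_ray_fps[OF derivation_dy _ that]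
    by (simp_all add: D derivation_dx derivation_dy)
  have "fps_to_fls (D dx U * D dy W - D dy U * D dx W) = ray (dx u * dy v - dy u * dx v)"
    by (simp add: ray.diff ray.mult x[OF assms(1)] x[OF assms(2)] y[OF assms(1)] y[OF assms(2)]
        fls_times_fps_to_fls)
  also have "\<dots> = 0" by (simp only: 0 ray.zero)
  finally have "(D dx U * D dy W - D dy U * D dx W) $ 0 = 0" by simp
  thus False by (simp add: D_def assms)
qed

text \<open>
  The series \<open>(U, W) = \<phi>(\<^bold>x z) / z\<close> satisfies two evolution equations. With the generator as a
  derivation \<open>L\<close> acting on coefficients, the generator equations at \<open>\<^bold>x z\<close> say \<open>U' = L U\<close>, where
  homogeneity turns \<open>P(\<^bold>x z)\<close> into \<open>z\<^sup>2 P(\<^bold>x)\<close>. To pass from this linear transport equation to the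
  ordinary differential equation \<open>U' = P(U, W)\<close>, note that both sides of the latter are solutions of
  \<open>Z' = L Z\<close> with the same constant term, and such a solution is determined by its constant term.
\<close>

lemma quadratic_generator_flow:
  assumes gen: "quadratic_generator u v P Q"
    and UW: "ray u = fls_X * fps_to_fls U" "ray v = fls_X * fps_to_fls W" "U $ 0 = x2" "W $ 0 = y2"
  shows "fls_deriv (fps_to_fls U) = ratfun_subst constL P (fps_to_fls U) (fps_to_fls W)"
    and "fls_deriv (fps_to_fls W) = ratfun_subst constL Q (fps_to_fls U) (fps_to_fls W)"
proof -
  interpret ray: ring_map ray by (rule ring_map_ray)
  have hom: "euler P = 2 * P" "euler Q = 2 * Q"
    and lin: "P * dx f + Q * dy f = euler f - f" if "f \<in> {u, v}" for f
    using gen that unfolding quadratic_generator_def by blast+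
  define L where "L f = P * dx f + Q * dy f" for f
  have L: "derivation L"
    by standard (simp_all add: L_def derivation.add[OF derivation_dx] derivation.add[OF derivation_dy]
      derivation.mult[OF derivation_dx] derivation.mult[OF derivation_dy] algebra_simps)
  have L_simps: "L x2 = P" "L y2 = Q" "L (const2 c) = 0" for c by (simp_all add: L_def)
  interpret LL: derivation "fls_map L" by (rule derivation_fls_map[OF L])
  have LL_constL: "fls_map L (constL c) = 0" for c
    by (simp add: constL_def fls_map_const derivation.zero[OF L] L_simps)
  have ray_hom: "ray w = fls_X ^ 2 * fls_const w" if "euler w = 2 * w" for w
  proof -
    have "alg_independent constL (fls_const x2) (fls_const y2)"
      using ratfun_subst_fps(1)[of "fps_const x2" "fps_const y2"] by simp
    thus ?thesis
      using homogeneous_ratfun_subst[OF that ring_map_constL, of "fls_const x2" "fls_const y2" fls_X]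
        alg_independent_ray
      by (simp add: ray_def ratfun_subst_constL_x2_y2 mult.commute)
  qed
  have evol: "fls_map L (fps_to_fls F) = fls_deriv (fps_to_fls F)"
    if f: "f \<in> {u, v}" and F: "ray f = fls_X * fps_to_fls F" for f F
  proof -
    have "fls_X ^ 2 * fls_map L (fps_to_fls F) = ray P * ray (dx f) + ray Q * ray (dy f)"
      unfolding fls_map_ray_fps[OF L L_simps(3) F] L_simps ray_hom[OF hom(1)[OF f]]
        ray_hom[OF hom(2)[OF f]]
      by (simp only: distrib_left mult.assoc)
    also have "\<dots> = fls_X * fls_deriv (ray f) - ray f"
      unfolding fls_deriv_ray by (simp only: lin[OF f] flip: ray.mult ray.add ray.diff)
    also have "\<dots> = fls_X ^ 2 * fls_deriv (fps_to_fls F)"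
      unfolding F by (simp add: power2_eq_square algebra_simps)
    finally show ?thesis by (metis fls_X_pow_nonzero mult_left_cancel)
  qed

  define S where "S f = ratfun_subst constL f (fps_to_fls U) (fps_to_fls W)" for f
  note indep = ratfun_subst_fps(1)[OF UW(3,4)]
  have flow: "fls_deriv (fps_to_fls F) = S w"
    if f: "f \<in> {u, v}" and F: "ray f = fls_X * fps_to_fls F" and w: "L (F $ 0) = w" for f F w
  proof -
    obtain g where g: "S w = fps_to_fls g" "g $ 0 = w"
      unfolding S_def using ratfun_subst_fps(2)[OF UW(3,4)] by blast
    have Z: "fps_to_fls (fps_deriv F - g) = fls_deriv (fps_to_fls F) - S w"
      by (simp add: g fls_deriv_fps_to_fls)
    \<comment> \<open>\<open>L\<close> and the derivative agree on \<open>U\<close> and \<open>W\<close>, hence, by the chain rule, on \<open>S w\<close>\<close>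
    have "fls_deriv (S w) = fls_map L (S w)"
      unfolding S_def
        derivation_ratfun_subst[OF ring_map_constL L[THEN derivation_fls_map] LL_constL indep]
      by (subst derivation_ratfun_subst[OF ring_map_constL derivation_fls_deriv _ indep])
         (simp_all add: constL_def evol[OF _ UW(1)] evol[OF _ UW(2)])
    hence "fls_deriv (fps_to_fls (fps_deriv F - g)) = fls_map L (fps_to_fls (fps_deriv F - g))"
      unfolding Z by (simp add: LL.diff evol[OF f F] flip: fls_deriv_fls_map[OF L])
    moreover have "(fps_deriv F - g) $ 0 = 0"
    proof -
      have "fps_deriv F $ 0 = fls_map L (fps_to_fls F) $$ 0"
        unfolding evol[OF f F] by (simp add: fls_deriv_fps_to_fls)
      thus ?thesis by (simp add: fls_map_nth derivation.zero[OF L] w g)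
    qed
    ultimately have "fps_deriv F - g = 0" by (rule fls_evolution_unique[OF L])
    hence "fls_deriv (fps_to_fls F) - S w = 0" by (simp flip: Z)
    thus ?thesis by simp
  qed
  show "fls_deriv (fps_to_fls U) = ratfun_subst constL P (fps_to_fls U) (fps_to_fls W)"
    using flow[OF _ UW(1)] by (simp add: S_def UW L_simps)
  show "fls_deriv (fps_to_fls W) = ratfun_subst constL Q (fps_to_fls U) (fps_to_fls W)"
    using flow[OF _ UW(2)] by (simp add: S_def UW L_simps)
qed

text \<open>
  With \<open>a = (1 - z) U\<close> and \<open>b = (1 - z) W\<close>, the flow equation and homogeneity give
  \<open>(1 - z) a' = P(a, b) - a\<close> and likewise for \<open>b\<close>. By the chain rule and the generator equations,
  \<open>(1 - z) (f(a, b))' = - f(a, b)\<close> for \<open>f = u, v\<close>. Hence \<open>f(a, b) / (1 - z)\<close> does not depend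
  on \<open>z\<close>, and at \<open>z = 0\<close> its value is \<open>f\<close>.
\<close>

lemma quadratic_generator_imp_translation_equation:
  assumes gen: "quadratic_generator u v P Q"
    and UW: "ray u = fls_X * fps_to_fls U" "ray v = fls_X * fps_to_fls W" "U $ 0 = x2" "W $ 0 = y2"
  shows "projective_translation_equation u v"
proof -
  have hom: "euler P = 2 * P" "euler Q = 2 * Q"
    using gen unfolding quadratic_generator_def by blast+
  define a where "a = (1 - fps_X) * U"
  define b where "b = (1 - fps_X) * W"
  have ab: "fps_to_fls a = (1 - fls_X) * fps_to_fls U" "fps_to_fls b = (1 - fls_X) * fps_to_fls W"
    by (simp_all add: a_def b_def fls_times_fps_to_fls)
  have ab0: "a $ 0 = x2" "b $ 0 = y2" by (simp_all add: a_def b_def UW)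
  note indep = ratfun_subst_fps(1)[OF ab0]
  define T where "T f = ratfun_subst constL f (fps_to_fls a) (fps_to_fls b)" for f
  interpret T: ring_map T unfolding T_def by (rule ring_map_ratfun_subst[OF ring_map_constL indep])
  have T_hom: "T w = (1 - fls_X) ^ 2 * ratfun_subst constL w (fps_to_fls U) (fps_to_fls W)"
    if "euler w = 2 * w" for w
    using homogeneous_ratfun_subst[OF that ring_map_constL ratfun_subst_fps(1)[OF UW(3,4)],
        of "1 - fls_X"] indep
    unfolding T_def ab by blast
  have T_x2: "T x2 = fps_to_fls a" and T_y2: "T y2 = fps_to_fls b"
    by (simp_all add: T_def ring_map_constL indep)
  have dab: "(1 - fls_X) * fls_deriv (fps_to_fls a) = T P - T x2"
    "(1 - fls_X) * fls_deriv (fps_to_fls b) = T Q - T y2"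
    unfolding T_hom[OF hom(1)] T_hom[OF hom(2)] T_x2 T_y2 ab
    by (simp_all add: quadratic_generator_flow[OF gen UW] power2_eq_square algebra_simps)
  have nz: "1 - fls_X \<noteq> (0 :: ratfun2 fls)"
  proof
    assume "1 - fls_X = (0 :: ratfun2 fls)"
    hence "(1 - fls_X) $$ 0 = (0 :: ratfun2)" by simp
    thus False by simp
  qed
  have "T f = (1 - fls_X) * fls_const f" if f: "f \<in> {u, v}" for f
  proof -
    have "P * dx f + Q * dy f = euler f - f"
      using gen f unfolding quadratic_generator_def by blast
    hence lin: "dx f * (P - x2) + dy f * (Q - y2) = - f"
      by (simp add: euler_def[of f] algebra_simps)
    have "fls_deriv (T f) = T (dx f) * fls_deriv (fps_to_fls a) + T (dy f) * fls_deriv (fps_to_fls b)"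
      unfolding T_def
      by (rule derivation_ratfun_subst[OF ring_map_constL derivation_fls_deriv _ indep])
         (simp add: constL_def)
    hence "(1 - fls_X) * fls_deriv (T f) =
        T (dx f) * ((1 - fls_X) * fls_deriv (fps_to_fls a))
        + T (dy f) * ((1 - fls_X) * fls_deriv (fps_to_fls b))"
      by (simp only: distrib_left mult_ac)
    also have "\<dots> = - T f"
      unfolding dab by (simp only: lin flip: T.mult T.add T.diff T.minus)
    finally have "fls_deriv (T f) * (1 - fls_X) - T f * fls_deriv (1 - fls_X) = 0"
      by (simp add: mult.commute)
    hence "fls_deriv (T f / (1 - fls_X)) = 0"
      by (subst derivation_divide[OF derivation_fls_deriv nz]) (simp only: div_0)
    then obtain c where "T f / (1 - fls_X) = fls_const c"
      using fls_deriv_eq_0_iff by metis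
    hence c: "T f = fls_const c * (1 - fls_X)" by (rule nonzero_divide_eq_eq[OF nz, THEN iffD1])
    obtain h where h: "T f = fps_to_fls h" "h $ 0 = f"
      unfolding T_def using ratfun_subst_fps(2)[OF ab0] by blast
    have "c = f" using arg_cong[OF c, of "\<lambda>F. F $$ 0"] by (simp add: h right_diff_distrib)
    thus ?thesis using c by (simp add: mult.commute)
  qed
  thus ?thesis
    unfolding projective_translation_equation_expand[OF UW] ab[symmetric] T_def[symmetric] by simp
qed

theorem proposition3:
  fixes u v :: ratfun2
  shows "(projective_translation_equation u v \<and> boundary_condition u v
            \<longrightarrow> projective_pde_system u v) \<and>
         (projective_pde_system u v \<and> boundary_condition u v
            \<longrightarrow> projective_translation_equation u v)"
proof (intro conjI impI; elim conjE)
  assume "projective_translation_equation u v" "boundary_condition u v"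
  thus "projective_pde_system u v"
    by (rule translation_equation_imp_quadratic_generator) (rule quadratic_generator_imp_pde_system)
next
  assume pde: "projective_pde_system u v" and "boundary_condition u v"
  from this(2) obtain U W where UW: "ray u = fls_X * fps_to_fls U" "ray v = fls_X * fps_to_fls W"
    "U $ 0 = x2" "W $ 0 = y2" by (rule boundary_condition_ray)
  from pde boundary_jacobian_nonzero[OF UW] obtain P Q where "quadratic_generator u v P Q"
    by (rule pde_system_imp_quadratic_generator)
  thus "projective_translation_equation u v"
    using UW by (rule quadratic_generator_imp_translation_equation)
qed

end
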